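(* Let $n\ge0$ be an integer and suppose $x$ is a monic monomial in standard form in $A_{C_2}^\vee(n)$. Then the directed graph $G_x^{\mathrm{dir}}$ is unilateral if and only if (1) for each $\xi_i^{2^j}\in A_{C_2}^\vee(n)$ (i.e. for all $i\ge1$, $j\ge0$ with $i+j\le n$), at least one summand of $c(\xi_i^{2^j})$ is a factor of $x$, (2) and $\tau_0$ is a factor of $x$.
   Context: Let $\mathbb{M}_2=\mathbb{F}_2[a,u]\oplus\frac{\mathbb{F}_2[a,u]}{(a^\infty,u^\infty)}\{\theta\}$ be the bigraded coefficient ring ($RO(C_2)$-graded homology of a point with coefficients in the constant Mackey functor $\underline{\mathbb{F}}_2$), $|a|=(-1,-1)$, $|u|=(0,-1)$. Let $A_{C_2}^\vee(n)=\mathbb{M}_2[\xi_1,\dots,\xi_n,\tau_0,\dots,\tau_n]/(\xi_i^{2^{n-i+1}},\ \tau_i^2=(u+a\tau_0)\xi_{i+1}+a\tau_{i+1})$ with $\xi_{n+1}=\tau_{n+1}=0$, a quotient of the $C_2$-equivariant dual Steenrod algebra (a Hopf algebroid over $\mathbb{M}_2$). A monic monomial in standard form is $x=\tau_0^{\epsilon_0}\cdots\tau_n^{\epsilon_n}\xi_1^{r_1}\cdots\xi_n^{r_n}$ with $\epsilon_i\in\{0,1\}$, $0\le r_i\le2^{n+1-i}-1$, the exponents being written in binary: $r_i=\sum_{j=0}^{n-i}c_{i,j}2^j$, $c_{i,j}\in\{0,1\}$. "Factor" means divisor as a monomial (exponentwise). The antipode $c$ is the ring homomorphism which on the $\xi$'s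 satisfies $c(\xi_0)=1$, where $\xi_0=1$, and $\sum_{k=0}^m\xi_{m-k}^{2^k}c(\xi_k)=0$ for $m\ge1$. The summands of $c(\xi_i^{2^j})=c(\xi_i)^{2^j}$ are the monomials occurring when it is expanded in the monomial basis. The graph $G_x$ is the undirected graph with vertex set $\{\sigma,\rho,2\rho,2^2\rho,\dots,2^n\rho\}$ ($n+2$ distinct vertices; $\sigma$ is the sign representation and $\rho=1+\sigma$ the regular representation of $C_2$) having: an edge (labelled $\tau_i$) between $\sigma$ and $2^i\rho$ for each $i$ with $\epsilon_i=1$; an edge (labelled $\xi_i^{2^j}$) between $2^j\rho$ and $2^{i+j}\rho$ for all $1\le i\le n$, $0\le j\le n-i$ with $c_{i,j}=1$; and no other edges. $G_x^{\mathrm{dir}}$ is $G_x$ with every edge oriented towards the vertex of larger representation dimension ($\sigma\to2^i\rho$, $2^j\rho\to2^{i+j}\rho$). A directed graph is unilateral if for every pair of distinct vertices $v,w$ there is a directed path from $v$ to $w$ or from $w$ to $v$.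
   Formalization: "Factor" is taken with respect to the binary exponents c_{i,j} of the ξ_i^{2^j} (so ξ_1 is not a factor of ξ_1^2), not the integer exponents r_i; with integer divisibility the claim fails, e.g. n=2, x=τ_0 ξ_1^2 ξ_2. *)

theory Defs
  imports
    "HOL-Library.Poly_Mapping"
    "HOL-Library.Product_Plus"
    "HOL-Library.Z2"
    "HOL-Algebra.QuotRing"
    "Graph_Theory.Arc_Walk"
begin

abbreviation lookup :: "('k \<Rightarrow>\<^sub>0 'r::zero) \<Rightarrow> 'k \<Rightarrow> 'r" where
  "lookup \<equiv> Poly_Mapping.lookup"

abbreviation keys :: "('k \<Rightarrow>\<^sub>0 'r::zero) \<Rightarrow> 'k set" where
  "keys \<equiv> Poly_Mapping.keys"

abbreviation single :: "'k \<Rightarrow> 'r::zero \<Rightarrow> 'k \<Rightarrow>\<^sub>0 'r" where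
  "single \<equiv> Poly_Mapping.single"

section \<open>The coefficient ring\<close>

text \<open>
  The module \<open>F\<^sub>2[a,u]/(a\<^sup>\<infinity>,u\<^sup>\<infinity>)\<close> has the \<open>F\<^sub>2\<close>-basis \<open>1/(a\<^sup>i\<^sup>+\<^sup>1 u\<^sup>j\<^sup>+\<^sup>1)\<close> with \<open>i, j \<ge> 0\<close>.
  Both it and \<open>F\<^sub>2[a,u]\<close> are written as finitely supported functions of the exponents:
  the index \<open>(i,j)\<close> stands for \<open>a\<^sup>i u\<^sup>j\<close> in the first case and for
  \<open>\<theta>/(a\<^sup>i\<^sup>+\<^sup>1 u\<^sup>j\<^sup>+\<^sup>1)\<close> in the second.  Multiplication by \<open>a\<^sup>k u\<^sup>l\<close> sends the basis
  element with index \<open>(i+k,j+l)\<close> to the one with index \<open>(i,j)\<close>, and kills the basis elements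
  whose index is not of this form.
\<close>

type_synonym f2_au = "(nat \<times> nat) \<Rightarrow>\<^sub>0 bit"
type_synonym f2_au_tors = "(nat \<times> nat) \<Rightarrow>\<^sub>0 bit"

definition tors_action :: "f2_au \<Rightarrow> f2_au_tors \<Rightarrow> f2_au_tors" where
  "tors_action p t =
    Abs_poly_mapping (\<lambda>e. \<Sum>d\<in>keys p. lookup p d * lookup t (e + d))"

lemma lookup_tors_action:
  "lookup (tors_action p t) e = (\<Sum>d\<in>keys p. lookup p d * lookup t (e + d))"
proof -
  let ?f = "\<lambda>e. \<Sum>d\<in>keys p. lookup p d * lookup t (e + d)"
  have "finite {e. e + d \<in> keys t}" for d
    by (rule finite_imageD[where f = "\<lambda>e. e + d"])
      (auto intro: finite_subset[OF _ finite_keys[of t]] inj_onI)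
  then have "finite (\<Union>d\<in>keys p. {e. e + d \<in> keys t})"
    by simp
  moreover have "{e. ?f e \<noteq> 0} \<subseteq> (\<Union>d\<in>keys p. {e. e + d \<in> keys t})"
  proof
    fix e assume "e \<in> {e. ?f e \<noteq> 0}"
    then obtain d where "d \<in> keys p" "lookup p d * lookup t (e + d) \<noteq> 0"
      by (metis (mono_tags, lifting) mem_Collect_eq sum.not_neutral_contains_not_neutral)
    then show "e \<in> (\<Union>d\<in>keys p. {e. e + d \<in> keys t})"
      by (auto simp: in_keys_iff)
  qed
  ultimately have "finite {e. ?f e \<noteq> 0}"
    by (rule finite_subset[rotated])
  then show ?thesis
    by (simp add: tors_action_def)
qed

lemma lookup_tors_action_superset:
  assumes "finite S" "keys p \<subseteq> S"
  shows "lookup (tors_action p t) e = (\<Sum>d\<in>S. lookup p d * lookup t (e + d))"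
  unfolding lookup_tors_action
  by (rule sum.mono_neutral_left) (use assms in \<open>auto simp: in_keys_iff\<close>)

lemma tors_action_add_right: "tors_action p (s + t) = tors_action p s + tors_action p t"
  by (rule poly_mapping_eqI)
    (simp only: lookup_tors_action lookup_add distrib_left sum.distrib)

lemma tors_action_add_left: "tors_action (p + q) t = tors_action p t + tors_action q t"
proof (rule poly_mapping_eqI)
  fix e
  let ?S = "keys p \<union> keys q"
  have S: "finite ?S" "keys (p + q) \<subseteq> ?S"
    "keys p \<subseteq> ?S" "keys q \<subseteq> ?S"
    using keys_add[of p q] by auto
  show "lookup (tors_action (p + q) t) e = lookup (tors_action p t + tors_action q t) e"
    unfolding lookup_add lookup_tors_action_superset[OF S(1,2)]
      lookup_tors_action_superset[OF S(1,3)] lookup_tors_action_superset[OF S(1,4)]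
    by (simp only: lookup_add distrib_right sum.distrib)
qed

lemma tors_action_zero_left [simp]: "tors_action 0 t = 0"
  by (rule poly_mapping_eqI) (simp add: lookup_tors_action)

lemma tors_action_zero_right [simp]: "tors_action p 0 = 0"
  by (rule poly_mapping_eqI) (simp add: lookup_tors_action)

lemma tors_action_single:
  "lookup (tors_action (single d r) t) e = r * lookup t (e + d)"
  by (simp add: lookup_tors_action)

lemma tors_action_one [simp]: "tors_action 1 t = t"
  by (rule poly_mapping_eqI) (simp add: lookup_tors_action)

lemma tors_action_mult: "tors_action (p * q) t = tors_action p (tors_action q t)"
proof -
  have dec: "p = (\<Sum>d\<in>keys p. single d (lookup p d))" for p :: f2_au
    by (rule poly_mapping_eqI)
      (auto simp: lookup_sum lookup_single when_def in_keys_iff sum.delta)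
  have sum_left: "tors_action (sum f S) t = (\<Sum>x\<in>S. tors_action (f x) t)"
    for f :: "nat \<times> nat \<Rightarrow> f2_au" and S t
    by (induction S rule: infinite_finite_induct) (simp_all add: tors_action_add_left)
  have sum_right: "tors_action q (sum f S) = (\<Sum>x\<in>S. tors_action q (f x))"
    for f :: "nat \<times> nat \<Rightarrow> f2_au_tors" and S q
    by (induction S rule: infinite_finite_induct) (simp_all add: tors_action_add_right)
  have single: "tors_action (single d r * single e s) t =
      tors_action (single d r) (tors_action (single e s) t)" for d e r s
    by (rule poly_mapping_eqI) (simp add: mult_single tors_action_single ac_simps)
  show ?thesis
    by (subst (1 2) dec[of p], subst (1 2) dec[of q])
      (simp only: sum_distrib_left sum_distrib_right sum_left sum_right single)
qed

text \<open>
  The ring structure is the square-zero extension: products of two elements of the negative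
  summand vanish.
\<close>

datatype M2 = M2 (pos: f2_au) (neg: f2_au_tors)

instantiation M2 :: comm_ring_1
begin

definition "0 = M2 0 0"
definition "1 = M2 1 0"
definition "x + y = M2 (pos x + pos y) (neg x + neg y)"
definition "- x = M2 (- pos x) (- neg x)"
definition "x - y = M2 (pos x - pos y) (neg x - neg y)" for x y :: M2
definition "x * y = M2 (pos x * pos y) (tors_action (pos x) (neg y) + tors_action (pos y) (neg x))"

instance
proof
  fix x y z :: M2
  show "x * y * z = x * (y * z)"
    by (simp add: times_M2_def tors_action_add_right mult.assoc mult.commute add.assoc
        flip: tors_action_mult)
  show "x * y = y * x"
    by (simp add: times_M2_def ac_simps)
  show "(x + y) * z = x * z + y * z"
    by (simp add: times_M2_def plus_M2_def tors_action_add_right tors_action_add_left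
        distrib_right distrib_left ac_simps)
qed (simp_all add: zero_M2_def one_M2_def plus_M2_def uminus_M2_def minus_M2_def times_M2_def
    ac_simps)

end

definition a_M2 :: M2 where "a_M2 = M2 (single (1, 0) 1) 0"
definition u_M2 :: M2 where "u_M2 = M2 (single (0, 1) 1) 0"

section \<open>The quotient of the dual Steenrod algebra\<close>

datatype gen = Xi nat | Tau nat

type_synonym mono = "gen \<Rightarrow>\<^sub>0 nat"
type_synonym mpoly = "mono \<Rightarrow>\<^sub>0 M2"

definition gens :: "nat \<Rightarrow> gen set" where
  "gens n = Xi ` {1..n} \<union> Tau ` {0..n}"

definition poly_ring :: "nat \<Rightarrow> mpoly ring" where
  "poly_ring n = \<lparr>carrier = {p. \<forall>m\<in>keys p. keys m \<subseteq> gens n},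
     mult = (*), one = 1, zero = 0, add = (+)\<rparr>"

abbreviation mono_of :: "gen \<Rightarrow> nat \<Rightarrow> mono" where
  "mono_of g r \<equiv> single g r"

abbreviation scalar :: "M2 \<Rightarrow> mpoly" where
  "scalar r \<equiv> single 0 r"

text \<open>The conventions \<open>\<xi>\<^sub>0 = 1\<close> and \<open>\<xi>\<^sub>i = \<tau>\<^sub>i = 0\<close> for \<open>i > n\<close> are built into the next two definitions.\<close>

definition xi :: "nat \<Rightarrow> nat \<Rightarrow> mpoly" where
  "xi n i = (if i = 0 then 1 else if i \<le> n then single (mono_of (Xi i) 1) 1 else 0)"

definition tau :: "nat \<Rightarrow> nat \<Rightarrow> mpoly" where
  "tau n i = (if i \<le> n then single (mono_of (Tau i) 1) 1 else 0)"

definition relations :: "nat \<Rightarrow> mpoly set" where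
  "relations n =
     {xi n i ^ (2 ^ (n - i + 1)) | i. 1 \<le> i \<and> i \<le> n} \<union>
     {tau n i ^ 2 - ((scalar u_M2 + scalar a_M2 * tau n 0) * xi n (i + 1)
        + scalar a_M2 * tau n (i + 1)) | i. i \<le> n}"

definition rel_ideal :: "nat \<Rightarrow> mpoly set" where
  "rel_ideal n = genideal (poly_ring n) (relations n)"

definition A_dual :: "nat \<Rightarrow> mpoly set ring" where
  "A_dual n = poly_ring n Quot rel_ideal n"

definition cls :: "nat \<Rightarrow> mpoly \<Rightarrow> mpoly set" where
  "cls n p = rel_ideal n +>\<^bsub>poly_ring n\<^esub> p"

section \<open>Monomials\<close>

text \<open>
  A monic monomial is represented by its exponent vector: \<open>lookup x (Tau i)\<close> is \<open>\<epsilon>\<^sub>i\<close> and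
  \<open>lookup x (Xi i)\<close> is \<open>r\<^sub>i\<close>.  The binary digit \<open>c\<^sub>i\<^sub>,\<^sub>j\<close> of \<open>r\<^sub>i\<close> is \<open>digit x i j\<close>.
\<close>

definition digit :: "mono \<Rightarrow> nat \<Rightarrow> nat \<Rightarrow> nat" where
  "digit x i j = lookup x (Xi i) div 2 ^ j mod 2"

definition standard_mono :: "nat \<Rightarrow> mono \<Rightarrow> bool" where
  "standard_mono n x \<longleftrightarrow> keys x \<subseteq> gens n \<and>
     (\<forall>i\<le>n. lookup x (Tau i) \<in> {0, 1}) \<and>
     (\<forall>i\<in>{1..n}. lookup x (Xi i) \<le> 2 ^ (n + 1 - i) - 1)"

text \<open>
  With the exponents written in binary, a standard monomial is the product of the generators
  \<open>\<tau>\<^sub>i\<close> and \<open>\<xi>\<^sub>i^(2^j)\<close> with exponents \<open>\<epsilon>\<^sub>i, c\<^sub>i\<^sub>,\<^sub>j \<in> {0,1}\<close>, and a factor is a divisor with respect to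
  these exponents.  This is finer than divisibility with respect to the integers \<open>r\<^sub>i\<close>: \<open>\<xi>\<^sub>1\<close> is not
  a factor of \<open>\<xi>\<^sub>1^2\<close>.  The distinction matters.  For \<open>n = 2\<close> and \<open>x = \<tau>\<^sub>0 \<xi>\<^sub>1^2 \<xi>\<^sub>2\<close>, all of
  \<open>\<tau>\<^sub>0, \<xi>\<^sub>1, \<xi>\<^sub>1^2, \<xi>\<^sub>2\<close> divide \<open>x\<close> in the coarser sense, although the directed graph of \<open>x\<close> has
  no path between \<open>\<rho>\<close> and \<open>2\<rho>\<close>.
\<close>

definition factor :: "mono \<Rightarrow> mono \<Rightarrow> bool" where
  "factor m x \<longleftrightarrow> (\<forall>i. lookup m (Tau i) \<le> lookup x (Tau i)) \<and> (\<forall>i j. digit m i j \<le> digit x i j)"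

text \<open>
  The standard monomials form an \<open>M\<^sub>2\<close>-basis of the quotient, so every element \<open>y\<close> is the class of
  exactly one polynomial \<open>p\<close> all of whose monomials are standard.  This \<open>p\<close> is the expansion of
  \<open>y\<close> in the monomial basis, and its keys are the monomials with nonzero coefficient.
\<close>

definition summand :: "nat \<Rightarrow> mpoly set \<Rightarrow> mono \<Rightarrow> bool" where
  "summand n y m \<longleftrightarrow>
     (\<exists>p. (\<forall>k\<in>keys p. standard_mono n k) \<and> y = cls n p \<and> m \<in> keys p)"

section \<open>The antipode\<close>

text \<open>
  The predicate records the properties of the antipode that pin down its values on the
  subalgebra generated by the \<open>\<xi>\<^sub>i\<close>: it is a ring homomorphism (in particular it need not be
  linear over the coefficients), and the recursion determines \<open>c(\<xi>\<^sub>m)\<close> since \<open>\<xi>\<^sub>0 = 1\<close>.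
  Its values on the coefficient ring and on the \<open>\<tau>\<^sub>i\<close> are left unconstrained.
\<close>

definition antipode_on_xi :: "nat \<Rightarrow> (mpoly set \<Rightarrow> mpoly set) \<Rightarrow> bool" where
  "antipode_on_xi n c \<longleftrightarrow> c \<in> ring_hom (A_dual n) (A_dual n) \<and>
     c (cls n (xi n 0)) = \<one>\<^bsub>A_dual n\<^esub> \<and>
     (\<forall>m\<ge>1. (\<Oplus>\<^bsub>A_dual n\<^esub>k\<in>{0..m}.
        cls n (xi n (m - k)) [^]\<^bsub>A_dual n\<^esub> ((2::nat) ^ k) \<otimes>\<^bsub>A_dual n\<^esub> c (cls n (xi n k))) = \<zero>\<^bsub>A_dual n\<^esub>)"

section \<open>The graph of a monomial\<close>

text \<open>\<open>Rho i\<close> is the vertex \<open>2\<^sup>i\<rho>\<close>.\<close>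

datatype rep = Sigma | Rho nat

fun rep_dim :: "rep \<Rightarrow> nat" where
  "rep_dim Sigma = 1"
| "rep_dim (Rho i) = 2 ^ i * 2"

text \<open>An undirected labelled edge is the set of its two endpoints together with its label.\<close>

type_synonym edge = "rep set \<times> mono"

definition graph_verts :: "nat \<Rightarrow> rep set" where
  "graph_verts n = insert Sigma (Rho ` {0..n})"

definition graph_edges :: "nat \<Rightarrow> mono \<Rightarrow> edge set" where
  "graph_edges n x =
     {({Sigma, Rho i}, mono_of (Tau i) 1) | i. i \<le> n \<and> lookup x (Tau i) = 1} \<union>
     {({Rho j, Rho (i + j)}, mono_of (Xi i) (2 ^ j)) | i j.
        1 \<le> i \<and> i \<le> n \<and> j \<le> n - i \<and> digit x i j = 1}"

definition dir_graph :: "nat \<Rightarrow> mono \<Rightarrow> (rep, edge) pre_digraph" where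
  "dir_graph n x = \<lparr>verts = graph_verts n, arcs = graph_edges n x,
     tail = (\<lambda>e. ARG_MIN rep_dim v. v \<in> fst e),
     head = (\<lambda>e. ARG_MAX rep_dim v. v \<in> fst e)\<rparr>"

definition unilateral :: "('v, 'e) pre_digraph \<Rightarrow> bool" where
  "unilateral G \<longleftrightarrow> (\<forall>v\<in>verts G. \<forall>w\<in>verts G. v \<noteq> w \<longrightarrow>
     (\<exists>p. pre_digraph.apath G v p w) \<or> (\<exists>p. pre_digraph.apath G w p v))"

end

theory Submission
  imports Defs
begin

text \<open>
  Unfolding the recursion writes the antipode of \<open>\<xi>\<^sub>i\<close> as a sum over the paths
  \<open>0 = k\<^sub>0 < k\<^sub>1 < \<dots> < k\<^sub>s = i\<close>, where each step from \<open>k\<close> to \<open>l\<close> contributes the factor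
  \<open>\<xi>\<^bsub>l-k\<^esub>^(2^k)\<close>; raising to the power \<open>2^j\<close> shifts these paths by \<open>j\<close>, by Frobenius.  Such a
  product consists of the labels of a directed path from \<open>2\<^sup>j\<rho>\<close> to \<open>2\<^sup>i\<^sup>+\<^sup>j\<rho>\<close>.  Distinct paths give
  distinct standard monomials, so nothing cancels, and since standard monomials are linearly
  independent in the quotient these are all the summands.  Hence the first condition says that
  any two vertices \<open>2\<^sup>j\<rho>\<close>, \<open>2\<^sup>l\<rho>\<close> are joined by a directed path, while \<open>\<sigma>\<close> and \<open>\<rho>\<close>, having the
  smallest dimensions, can only be joined by the edge \<open>\<tau>\<^sub>0\<close>.
\<close>

section \<open>Normal forms modulo monomial rewriting\<close>

lemma poly_mapping_additive_induct [case_names single add]: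
  assumes single: "\<And>m c. P (single m c)" and add: "\<And>p q. P p \<Longrightarrow> P q \<Longrightarrow> P (p + q)"
  shows "P (p :: 'm \<Rightarrow>\<^sub>0 'a::comm_monoid_add)"
proof -
  have "P (\<Sum>m\<in>S. single m (lookup p m))" if "finite S" for S
    using that
  proof (induction S)
    case empty
    show ?case using single[of undefined 0] by simp
  qed (simp add: add single)
  moreover have "p = (\<Sum>m\<in>keys p. single m (lookup p m))"
    by (rule poly_mapping_eqI) (auto simp: lookup_sum lookup_single when_def in_keys_iff)
  ultimately show ?thesis
    by (metis finite_keys)
qed

text \<open>Scalars act as constant polynomials \<open>single 0 c\<close>, so linearity reduces to
  the ring laws.\<close>

definition linear_extension ::
    "('m \<Rightarrow> 'm \<Rightarrow>\<^sub>0 'a) \<Rightarrow> ('m \<Rightarrow>\<^sub>0 'a) \<Rightarrow> 'm::comm_monoid_add \<Rightarrow>\<^sub>0 'a::comm_ring_1" where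
  "linear_extension f p = (\<Sum>m\<in>keys p. single 0 (lookup p m) * f m)"

text \<open>As a congruence rule for \<open>function\<close>, this restricts the recursive calls of
  \<open>nf\<close> to monomials in the support of \<open>r v\<close>, where \<open>W_less\<close>
  applies.\<close>

lemma linear_extension_cong [fundef_cong]:
  assumes "p = q" "\<And>k. k \<in> keys q \<Longrightarrow> f k = g k"
  shows "linear_extension f p = linear_extension g q"
  unfolding linear_extension_def using assms by (auto intro: sum.cong)

lemma linear_extension_superset:
  assumes "finite S" "keys p \<subseteq> S"
  shows "linear_extension f p = (\<Sum>m\<in>S. single 0 (lookup p m) * f m)"
  unfolding linear_extension_def
  by (rule sum.mono_neutral_left) (use assms in \<open>auto simp: in_keys_iff\<close>)

lemma linear_extension_zero [simp]: "linear_extension f 0 = 0"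
  by (simp add: linear_extension_def)

lemma linear_extension_single [simp]: "linear_extension f (single m c) = single 0 c * f m"
  by (simp add: linear_extension_def)

lemma linear_extension_add:
  "linear_extension f (p + q) = linear_extension f p + linear_extension f q"
proof -
  have "finite (keys p \<union> keys q)" "keys (p + q) \<subseteq> keys p \<union> keys q"
    using keys_add[of p q] by auto
  then show ?thesis
    by (simp add: linear_extension_superset[of "keys p \<union> keys q"] lookup_add single_add
        distrib_right sum.distrib)
qed

lemma linear_extension_uminus: "linear_extension f (- p) = - linear_extension f p"
  using linear_extension_add[of f p "- p"] by (simp add: eq_neg_iff_add_eq_0 add.commute)

lemma linear_extension_diff:
  "linear_extension f (p - q) = linear_extension f p - linear_extension f q"
  using linear_extension_add[of f p "- q"] by (simp add: linear_extension_uminus)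

lemma linear_extension_monomial_mult:
  "linear_extension f (single m c * p) = single 0 c * linear_extension (\<lambda>k. f (m + k)) p"
proof (induction p rule: poly_mapping_additive_induct)
  case (single k b)
  have "linear_extension f (single m c * single k b) = single 0 (c * b) * f (m + k)"
    by (simp add: mult_single)
  also have "single 0 (c * b) = single 0 c * (single 0 b :: 'a \<Rightarrow>\<^sub>0 'b)"
    by (simp add: mult_single)
  finally show ?case
    by (simp add: mult.assoc)
qed (simp add: distrib_left linear_extension_add)

lemma linear_extension_swap:
  "linear_extension (\<lambda>k. linear_extension (f k) p) q =
   linear_extension (\<lambda>l. linear_extension (\<lambda>k. f k l) q) p"
  unfolding linear_extension_def sum_distrib_left
  by (subst sum.swap) (simp add: mult.left_commute)

text \<open>
  Rewriting \<open>v\<^bsup>d v\<^esup> \<rightarrow> r v\<close> for each variable \<open>v\<close>, where the weight \<open>W\<close> guarantees termination.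
  The leading monomials of different rules are coprime, so any two rewriting steps commute
  and the normal form does not depend on the choices.
\<close>

locale monomial_rewriting =
  fixes d :: "'v \<Rightarrow> nat"
    and r :: "'v \<Rightarrow> ('v \<Rightarrow>\<^sub>0 nat) \<Rightarrow>\<^sub>0 'a::comm_ring_1"
    and W :: "('v \<Rightarrow>\<^sub>0 nat) \<Rightarrow> nat"
  assumes W_add: "W (m + k) = W m + W k"
    and W_less: "k \<in> keys (r v) \<Longrightarrow> W k < W (single v (d v))"
begin

definition reduced :: "('v \<Rightarrow>\<^sub>0 nat) \<Rightarrow> bool" where
  "reduced m \<longleftrightarrow> (\<forall>v. lookup m v < d v)"

lemma split_off_power:
  assumes "d v \<le> lookup m v"
  shows "m = single v (d v) + (m - single v (d v))"
  by (rule poly_mapping_eqI)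
    (use assms in \<open>auto simp: lookup_add lookup_minus lookup_single when_def\<close>)

function nf :: "('v \<Rightarrow>\<^sub>0 nat) \<Rightarrow> ('v \<Rightarrow>\<^sub>0 nat) \<Rightarrow>\<^sub>0 'a" where
  "nf m = (if reduced m then single m 1 else
     (let v = SOME v. d v \<le> lookup m v
      in linear_extension (\<lambda>k. nf (k + (m - single v (d v)))) (r v)))"
  by pat_completeness auto
termination
proof (relation "measure W")
  fix m v k
  assume "\<not> reduced m" and v: "v = (SOME v. d v \<le> lookup m v)" and k: "k \<in> keys (r v)"
  then have "\<exists>v. d v \<le> lookup m v"
    by (auto simp: reduced_def not_less)
  then have "d v \<le> lookup m v"
    unfolding v by (rule someI_ex)
  then have "W m = W (single v (d v)) + W (m - single v (d v))"
    by (metis split_off_power W_add)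
  then show "(k + (m - single v (d v)), m) \<in> measure W"
    using W_less[OF k] by (simp add: W_add)
qed simp

declare nf.simps [simp del]

lemma nf_reduced: "reduced m \<Longrightarrow> nf m = single m 1"
  by (simp add: nf.simps)

text \<open>Independence of the choice made by \<open>SOME\<close>, by induction on the weight: if
  \<open>nf\<close> picks another variable \<open>w\<close>, both leading powers split off, and
  rewriting \<open>v\<close> and \<open>w\<close> in either order gives the same double sum.\<close>

lemma nf_rewrite: "nf (single v (d v) + m) = linear_extension (\<lambda>k. nf (k + m)) (r v)"
proof (induction "W (single v (d v) + m)" arbitrary: v m rule: less_induct)
  case less
  define M where "M = single v (d v) + m"
  have "d v \<le> lookup M v"
    by (simp add: M_def lookup_add)
  then have not_red: "\<not> reduced M"
    by (auto simp: reduced_def not_less)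
  define w where "w = (SOME w. d w \<le> lookup M w)"
  have w: "d w \<le> lookup M w"
    unfolding w_def by (rule someI) fact
  have nf_M: "nf M = linear_extension (\<lambda>k. nf (k + (M - single w (d w)))) (r w)"
    using not_red by (subst nf.simps) (simp add: w_def Let_def)
  show ?case
  proof (cases "w = v")
    case True
    then show ?thesis
      using nf_M by (simp add: M_def)
  next
    case False
    define m' where "m' = m - single w (d w)"
    have "d w \<le> lookup m w"
      using w False by (simp add: M_def lookup_add lookup_single)
    then have m: "m = single w (d w) + m'"
      unfolding m'_def by (rule split_off_power)
    have "M = (single v (d v) + m') + single w (d w)"
      by (simp add: M_def m ac_simps)
    then have "M - single w (d w) = single v (d v) + m'"
      by (simp only: add_diff_cancel_right')
    then have "nf M = linear_extension (\<lambda>k. nf (single v (d v) + (k + m'))) (r w)"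
      unfolding nf_M by (simp add: ac_simps)
    \<comment> \<open>The \<open>w\<close>-power has been replaced by a lighter \<open>k\<close>, so
      the induction hypothesis rewrites \<open>v\<close>. After the swap it is used backwards with
      the two variables exchanged.\<close>
    also have "\<dots> = linear_extension (\<lambda>k. linear_extension (\<lambda>l. nf (l + (k + m'))) (r v)) (r w)"
      by (rule linear_extension_cong[OF refl less]) (use W_less m in \<open>simp add: W_add\<close>)
    also have "\<dots> = linear_extension (\<lambda>l. linear_extension (\<lambda>k. nf (k + (l + m'))) (r w)) (r v)"
      by (subst linear_extension_swap) (simp add: ac_simps)
    also have "\<dots> = linear_extension (\<lambda>l. nf (single w (d w) + (l + m'))) (r v)"
      by (rule linear_extension_cong[OF refl less[symmetric]])
        (use W_less m in \<open>simp add: W_add\<close>)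
    finally show ?thesis
      by (simp add: M_def m ac_simps)
  qed
qed

text \<open>The largest ideal on which the normal form vanishes; quantifying over all multipliers
  makes closure under multiplication immediate.\<close>

definition kernel :: "(('v \<Rightarrow>\<^sub>0 nat) \<Rightarrow>\<^sub>0 'a) set" where
  "kernel = {p. \<forall>q. linear_extension nf (q * p) = 0}"

text \<open>By additivity in the multiplier it suffices to treat monomials, where this is
  \<open>nf_rewrite\<close>.\<close>

lemma relation_in_kernel: "single (single v (d v)) 1 - r v \<in> kernel"
proof -
  have "linear_extension nf (q * (single (single v (d v)) 1 - r v)) = 0" for q
  proof (induction q rule: poly_mapping_additive_induct)
    case (single m c)
    have "single m c * (single (single v (d v)) 1 - r v) =
        single (m + single v (d v)) c - single m c * r v"
      by (simp add: right_diff_distrib mult_single)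
    then show ?case
      by (simp add: linear_extension_diff linear_extension_monomial_mult
          nf_rewrite[of v m, simplified add.commute[of _ m]] add.commute)
  qed (simp add: distrib_right linear_extension_add)
  then show ?thesis
    by (simp add: kernel_def)
qed

lemma kernel_zero: "0 \<in> kernel"
  by (simp add: kernel_def)

lemma kernel_add: "p \<in> kernel \<Longrightarrow> q \<in> kernel \<Longrightarrow> p + q \<in> kernel"
  by (simp add: kernel_def distrib_left linear_extension_add)

lemma kernel_uminus: "p \<in> kernel \<Longrightarrow> - p \<in> kernel"
  by (simp add: kernel_def linear_extension_uminus)

lemma kernel_mult:
  assumes "p \<in> kernel"
  shows "q * p \<in> kernel" "p * q \<in> kernel"
proof -
  show "q * p \<in> kernel"
    using assms by (simp add: kernel_def flip: mult.assoc)
  then show "p * q \<in> kernel"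
    by (simp add: mult.commute)
qed

lemma linear_extension_nf_reduced:
  assumes "\<forall>m\<in>keys p. reduced m"
  shows "linear_extension nf p = p"
proof -
  have "linear_extension nf p = (\<Sum>m\<in>keys p. single m (lookup p m))"
    unfolding linear_extension_def
    by (rule sum.cong) (use assms in \<open>simp_all add: nf_reduced mult_single\<close>)
  also have "\<dots> = p"
    by (rule poly_mapping_eqI) (auto simp: lookup_sum lookup_single when_def in_keys_iff)
  finally show ?thesis .
qed

text \<open>The normal form fixes reduced polynomials and, taking the multiplier 1, kills their
  difference.\<close>

lemma reduced_unique:
  assumes "\<forall>m\<in>keys p. reduced m" "\<forall>m\<in>keys q. reduced m" "p - q \<in> kernel"
  shows "p = q"
proof -
  have "linear_extension nf (1 * (p - q)) = 0"
    using assms(3) by (simp add: kernel_def del: mult_1)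
  then show ?thesis
    using assms(1,2) by (simp add: linear_extension_diff linear_extension_nf_reduced)
qed

end

section \<open>Linear independence of the standard monomials\<close>

lemma carrier_poly_ring:
  "p \<in> carrier (poly_ring n) \<longleftrightarrow> (\<forall>m\<in>keys p. keys m \<subseteq> gens n)"
  by (simp add: poly_ring_def)

lemma poly_ring_simps [simp]:
  "p \<otimes>\<^bsub>poly_ring n\<^esub> q = p * q" "p \<oplus>\<^bsub>poly_ring n\<^esub> q = p + q"
  "\<one>\<^bsub>poly_ring n\<^esub> = 1" "\<zero>\<^bsub>poly_ring n\<^esub> = 0"
  by (simp_all add: poly_ring_def)

lemma poly_ring_closed:
  assumes "p \<in> carrier (poly_ring n)" "q \<in> carrier (poly_ring n)"
  shows "p + q \<in> carrier (poly_ring n)" "p - q \<in> carrier (poly_ring n)"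
    "p * q \<in> carrier (poly_ring n)" "- p \<in> carrier (poly_ring n)"
proof -
  show "p + q \<in> carrier (poly_ring n)"
    using assms keys_add[of p q] by (auto simp: carrier_poly_ring)
  show "p - q \<in> carrier (poly_ring n)"
    using assms keys_diff[of p q] by (auto simp: carrier_poly_ring)
  show "- p \<in> carrier (poly_ring n)"
    using assms by (simp add: carrier_poly_ring)
  have "keys (k + l) \<subseteq> gens n" if "k \<in> keys p" "l \<in> keys q" for k l
    using that assms keys_add[of k l] by (fastforce simp: carrier_poly_ring)
  then show "p * q \<in> carrier (poly_ring n)"
    using keys_mult[of p q] by (fastforce simp: carrier_poly_ring)
qed

lemma single_in_poly_ring: "keys m \<subseteq> gens n \<Longrightarrow> single m c \<in> carrier (poly_ring n)"
  by (simp add: carrier_poly_ring)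

lemma poly_ring_zero_one: "0 \<in> carrier (poly_ring n)" "1 \<in> carrier (poly_ring n)"
  by (simp_all add: carrier_poly_ring)

lemma poly_ring_power: "p \<in> carrier (poly_ring n) \<Longrightarrow> p ^ k \<in> carrier (poly_ring n)"
  by (induction k) (simp_all add: poly_ring_closed poly_ring_zero_one)

lemma poly_ring_sum:
  "(\<And>k. k \<in> S \<Longrightarrow> f k \<in> carrier (poly_ring n)) \<Longrightarrow> sum f S \<in> carrier (poly_ring n)"
  by (induction S rule: infinite_finite_induct) (simp_all add: poly_ring_closed poly_ring_zero_one)

lemma xi_in_poly_ring: "xi n i \<in> carrier (poly_ring n)"
  by (auto simp: xi_def gens_def intro!: single_in_poly_ring poly_ring_zero_one)

lemma tau_in_poly_ring: "tau n i \<in> carrier (poly_ring n)"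
  by (auto simp: tau_def gens_def intro!: single_in_poly_ring poly_ring_zero_one)

lemma cring_poly_ring: "cring (poly_ring n)"
proof (intro cringI abelian_groupI comm_monoidI)
  show "\<exists>q\<in>carrier (poly_ring n). q \<oplus>\<^bsub>poly_ring n\<^esub> p = \<zero>\<^bsub>poly_ring n\<^esub>"
    if "p \<in> carrier (poly_ring n)" for p
    using poly_ring_closed(4)[OF that that] by (auto intro!: bexI[of _ "- p"])
qed (simp_all add: poly_ring_closed poly_ring_zero_one algebra_simps)

lemma poly_ring_nat_pow [simp]: "p [^]\<^bsub>poly_ring n\<^esub> (k::nat) = p ^ k"
  by (induction k) (simp_all add: nat_pow_def mult.commute)

lemma relations_in_poly_ring: "relations n \<subseteq> carrier (poly_ring n)"
  by (auto simp: relations_def intro!: poly_ring_closed poly_ring_power xi_in_poly_ring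
      tau_in_poly_ring single_in_poly_ring)

lemma ideal_rel_ideal: "ideal (rel_ideal n) (poly_ring n)"
  unfolding rel_ideal_def
  by (rule ring.genideal_ideal[OF cring.axioms(1)[OF cring_poly_ring] relations_in_poly_ring])

lemma cls_ring_hom: "ring_hom_ring (poly_ring n) (A_dual n) (cls n)"
proof -
  have "cls n = (+>\<^bsub>poly_ring n\<^esub>) (rel_ideal n)"
    by (rule ext) (simp add: cls_def)
  then show ?thesis
    using ideal.rcos_ring_hom_ring[OF ideal_rel_ideal] by (simp add: A_dual_def)
qed

lemma cls_eq_imp_diff_in_rel_ideal:
  assumes "p \<in> carrier (poly_ring n)" "q \<in> carrier (poly_ring n)" "cls n p = cls n q"
  shows "p - q \<in> rel_ideal n"
proof -
  interpret ideal "rel_ideal n" "poly_ring n"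
    by (rule ideal_rel_ideal)
  have "p \<in> cls n p"
    using a_rcos_self[of p] assms(1) by (simp add: cls_def)
  then show ?thesis
    unfolding assms(3) by (auto simp: cls_def a_r_coset_def')
qed

section \<open>The defining relations as terminating rewriting rules\<close>

lemma single_generator_power:
  "single (single v (Suc 0)) 1 ^ k = single (single v k) (1::'a::comm_ring_1)"
  by (induction k) (simp_all add: mult_single flip: single_add)

text \<open>The locale wants a rule for every variable of type \<open>gen\<close>; those outside
  \<open>gens n\<close> are rewritten to 0 (bound 1, reduct 0), so reduced monomials avoid
  them.\<close>

definition exponent_bound :: "nat \<Rightarrow> gen \<Rightarrow> nat" where
  "exponent_bound n v =
     (case v of Xi i \<Rightarrow> if 1 \<le> i \<and> i \<le> n then 2 ^ (n - i + 1) else 1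
      | Tau i \<Rightarrow> if i \<le> n then 2 else 1)"

definition reduct :: "nat \<Rightarrow> gen \<Rightarrow> mpoly" where
  "reduct n v =
     (case v of Xi i \<Rightarrow> 0
      | Tau i \<Rightarrow> if i \<le> n then (scalar u_M2 + scalar a_M2 * tau n 0) * xi n (i + 1)
          + scalar a_M2 * tau n (i + 1) else 0)"

text \<open>The termination weight: a square of some \<open>Tau i\<close> is replaced by terms
  containing at most one \<open>Tau\<close>, and the rules for \<open>Xi i\<close> have right-hand
  side 0.\<close>

definition tau_degree :: "mono \<Rightarrow> nat" where
  "tau_degree m = (\<Sum>v\<in>keys m \<inter> range Tau. lookup m v)"

lemma tau_degree_add: "tau_degree (m + k) = tau_degree m + tau_degree k"
proof -
  let ?S = "(keys m \<union> keys k) \<inter> range Tau"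
  have superset: "tau_degree l = (\<Sum>v\<in>?S. lookup l v)" if "keys l \<subseteq> keys m \<union> keys k" for l
    unfolding tau_degree_def
    by (rule sum.mono_neutral_left) (use that in \<open>auto simp: in_keys_iff\<close>)
  show ?thesis
    using keys_add[of m k] by (simp add: superset lookup_add sum.distrib)
qed

lemma tau_degree_single [simp]:
  "tau_degree (single (Tau i) e) = e" "tau_degree (single (Xi i) e) = 0"
proof -
  have "{Tau i} \<inter> range Tau = {Tau i}" "{Xi i} \<inter> range Tau = {}"
    by auto
  then show "tau_degree (single (Tau i) e) = e" "tau_degree (single (Xi i) e) = 0"
    by (simp_all add: tau_degree_def)
qed

lemma tau_degree_reduct:
  assumes "k \<in> keys (reduct n v)"
  shows "tau_degree k < tau_degree (single v (exponent_bound n v))"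
proof -
  \<comment> \<open>For \<open>i = n\<close> the reduct is 0, because \<open>xi n (n + 1)\<close>
    and \<open>tau n (n + 1)\<close> vanish by convention.\<close>
  obtain i where v: "v = Tau i" and "i + 1 \<le> n"
    using assms by (cases v) (auto simp: reduct_def xi_def tau_def split: if_splits)
  then have "reduct n v = single (single (Xi (i + 1)) 1) u_M2
      + single (single (Tau 0) 1 + single (Xi (i + 1)) 1) a_M2
      + single (single (Tau (i + 1)) 1) a_M2"
    by (simp add: reduct_def xi_def tau_def mult_single distrib_right)
  then have "k \<in> {single (Xi (i + 1)) 1, single (Tau 0) 1 + single (Xi (i + 1)) 1,
      single (Tau (i + 1)) 1}"
    using assms by (auto dest!: subsetD[OF keys_add] split: if_splits)
  then show ?thesis
    using v \<open>i + 1 \<le> n\<close> by (auto simp: tau_degree_add exponent_bound_def)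
qed

interpretation rewriting: monomial_rewriting "exponent_bound n" "reduct n" tau_degree for n
  by unfold_locales (simp_all add: tau_degree_add tau_degree_reduct)

lemma standard_mono_reduced: "standard_mono n m \<Longrightarrow> rewriting.reduced n m"
  unfolding rewriting.reduced_def
proof
  fix v
  assume m: "standard_mono n m"
  have outside: "lookup m v = 0" if "v \<notin> gens n"
    using m that by (auto simp: standard_mono_def in_keys_iff)
  show "lookup m v < exponent_bound n v"
  proof (cases v)
    case (Xi i)
    show ?thesis
    proof (cases "1 \<le> i \<and> i \<le> n")
      case True
      then have "lookup m (Xi i) \<le> 2 ^ (n + 1 - i) - 1" and eq: "n - i + 1 = n + 1 - i"
        using m by (auto simp: standard_mono_def)
      note this(1)
      also have "(2::nat) ^ (n + 1 - i) - 1 < 2 ^ (n - i + 1)"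
        unfolding eq by (rule diff_less) simp_all
      finally have "lookup m (Xi i) < 2 ^ (n - i + 1)" .
      then show ?thesis
        using True Xi by (simp add: exponent_bound_def)
    next
      case False
      then show ?thesis
        using outside Xi by (auto simp: exponent_bound_def gens_def image_iff)
    qed
  next
    case (Tau i)
    show ?thesis
    proof (cases "i \<le> n")
      case True
      then have "lookup m (Tau i) \<in> {0, 1}"
        using m unfolding standard_mono_def by blast
      then show ?thesis
        using True Tau by (auto simp: exponent_bound_def)
    next
      case False
      then show ?thesis
        using outside Tau by (auto simp: exponent_bound_def gens_def image_iff)
    qed
  qed
qed

text \<open>The kernel lives in polynomials over all of \<open>gen\<close>; cut down to the carrier
  it is an ideal of \<open>poly_ring n\<close> containing the relations, hence contains the ideal
  they generate.\<close>

lemma rel_ideal_subset_kernel: "rel_ideal n \<subseteq> rewriting.kernel n"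
proof -
  let ?K = "rewriting.kernel n \<inter> carrier (poly_ring n)"
  interpret cring "poly_ring n"
    by (rule cring_poly_ring)
  have minus: "\<ominus>\<^bsub>poly_ring n\<^esub> p = - p" if "p \<in> carrier (poly_ring n)" for p
    using that poly_ring_closed(4)[OF that that]
    by (intro minus_equality) simp_all
  have "ideal ?K (poly_ring n)"
  proof (rule idealI)
    show "subgroup ?K (add_monoid (poly_ring n))"
    proof (rule add.subgroupI)
      show "?K \<noteq> {}"
        using rewriting.kernel_zero poly_ring_zero_one(1) by blast
    qed (auto simp: minus poly_ring_closed rewriting.kernel_add rewriting.kernel_uminus)
  qed (auto simp: poly_ring_closed rewriting.kernel_mult ring_axioms)
  moreover have "relations n \<subseteq> ?K"
  proof
    fix p assume p: "p \<in> relations n"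
    have "p \<in> rewriting.kernel n"
      using p unfolding relations_def
    proof (elim UnE CollectE exE conjE)
      fix i assume "p = xi n i ^ 2 ^ (n - i + 1)" "1 \<le> i" "i \<le> n"
      then show ?thesis
        using rewriting.relation_in_kernel[of "Xi i" n]
        by (simp add: exponent_bound_def reduct_def xi_def single_generator_power)
    next
      fix i assume "p = tau n i ^ 2 - ((scalar u_M2 + scalar a_M2 * tau n 0) * xi n (i + 1)
        + scalar a_M2 * tau n (i + 1))" "i \<le> n"
      then show ?thesis
        using rewriting.relation_in_kernel[of "Tau i" n]
        by (simp add: exponent_bound_def reduct_def tau_def[of n i] single_generator_power)
    qed
    then show "p \<in> ?K"
      using p relations_in_poly_ring by blast
  qed
  ultimately show ?thesis
    unfolding rel_ideal_def by (meson genideal_minimal le_infE)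
qed

lemma standard_in_poly_ring:
  "\<forall>k\<in>keys p. standard_mono n k \<Longrightarrow> p \<in> carrier (poly_ring n)"
  by (simp add: carrier_poly_ring standard_mono_def)

text \<open>Linear independence of standard monomials in the quotient; it makes the existential
  polynomial in \<open>summand\<close> unique.\<close>

lemma standard_expansion_unique:
  assumes "\<forall>k\<in>keys p. standard_mono n k" "\<forall>k\<in>keys q. standard_mono n k" "cls n p = cls n q"
  shows "p = q"
proof (rule rewriting.reduced_unique[of _ n])
  show "p - q \<in> rewriting.kernel n"
    using cls_eq_imp_diff_in_rel_ideal[OF _ _ assms(3)] assms(1,2) standard_in_poly_ring
      rel_ideal_subset_kernel by blast
qed (use assms in \<open>auto intro: standard_mono_reduced\<close>)

section \<open>The summands of the antipode\<close>

lemma mpoly_add_self: "p + p = (0 :: mpoly)"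
proof (rule poly_mapping_eqI)
  fix m
  have bit: "b + b = 0" for b :: bit
    by (cases b) simp_all
  have f2: "q + q = 0" for q :: f2_au
    by (rule poly_mapping_eqI) (simp only: lookup_add bit lookup_zero)
  show "lookup (p + p) m = lookup 0 m"
    by (simp only: lookup_add plus_M2_def zero_M2_def f2 lookup_zero)
qed

lemma mpoly_frobenius_add: "(p + q) ^ 2 ^ j = p ^ 2 ^ j + (q :: mpoly) ^ 2 ^ j"
proof (induction j)
  case (Suc j)
  have square: "(a + b)\<^sup>2 = a\<^sup>2 + b\<^sup>2" for a b :: mpoly
    using mpoly_add_self[of "a * b"] by (simp add: power2_eq_square algebra_simps)
  show ?case
    by (simp only: power_Suc2 power_mult Suc square)
qed simp

lemma mpoly_frobenius_sum: "sum f S ^ 2 ^ j = (\<Sum>k\<in>S. (f k :: mpoly) ^ 2 ^ j)"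
  by (induction S rule: infinite_finite_induct) (simp_all add: mpoly_frobenius_add power_0_left)

text \<open>The antipode recursion solved for its last term and lifted to polynomials; the sign
  disappears in characteristic two.\<close>

fun conj_xi :: "nat \<Rightarrow> nat \<Rightarrow> mpoly" where
  "conj_xi n m = (if m = 0 then 1 else (\<Sum>k<m. xi n (m - k) ^ 2 ^ k * conj_xi n k))"

declare conj_xi.simps [simp del]

lemma conj_xi_in_poly_ring: "conj_xi n m \<in> carrier (poly_ring n)"
proof (induction m rule: less_induct)
  case (less m)
  then show ?case
    by (subst conj_xi.simps)
      (auto intro!: poly_ring_zero_one poly_ring_sum poly_ring_closed poly_ring_power
        xi_in_poly_ring)
qed

text \<open>By induction the terms \<open>k < m\<close> of the recursion sum to the class of
  \<open>conj_xi n m\<close>. The remaining term is the antipode of \<open>xi n m\<close>, and every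
  class is its own negative.\<close>

lemma antipode_eq_cls_conj_xi:
  assumes "antipode_on_xi n c"
  shows "c (cls n (xi n m)) = cls n (conj_xi n m)"
proof (induction m rule: less_induct)
  case (less m)
  interpret ring_hom_ring "poly_ring n" "A_dual n" "cls n"
    by (rule cls_ring_hom)
  have c: "c \<in> ring_hom (A_dual n) (A_dual n)"
    using assms by (simp add: antipode_on_xi_def)
  show ?case
  proof (cases "m = 0")
    case True
    then show ?thesis
      using assms hom_one by (simp add: antipode_on_xi_def conj_xi.simps)
  next
    case False
    let ?t = "\<lambda>k. cls n (xi n (m - k)) [^]\<^bsub>A_dual n\<^esub> ((2::nat) ^ k) \<otimes>\<^bsub>A_dual n\<^esub> c (cls n (xi n k))"
    have c_closed: "c (cls n (xi n k)) \<in> carrier (A_dual n)" for k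
      using ring_hom_closed[OF c] xi_in_poly_ring by simp
    have sum_cls: "cls n (sum f S) = (\<Oplus>\<^bsub>A_dual n\<^esub>k\<in>S. cls n (f k))"
      if "\<And>k. f k \<in> carrier (poly_ring n)" "finite S" for f and S :: "nat set"
      using that(2)
    proof (induction S)
      case empty
      show ?case using hom_zero by simp
    next
      case (insert k S)
      then show ?case
        using that(1) hom_add[of "f k" "sum f S"]
        by (simp add: poly_ring_sum S.finsum_insert Pi_def)
    qed
    have "?t k = cls n (xi n (m - k) ^ 2 ^ k * conj_xi n k)" if "k < m" for k
      using less[OF that] hom_mult[of "xi n (m - k) ^ 2 ^ k" "conj_xi n k"]
        hom_nat_pow[of "xi n (m - k)" "2 ^ k"]
      by (simp add: xi_in_poly_ring conj_xi_in_poly_ring poly_ring_power)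
    then have "(\<Oplus>\<^bsub>A_dual n\<^esub>k\<in>{..<m}. ?t k)
        = (\<Oplus>\<^bsub>A_dual n\<^esub>k\<in>{..<m}. cls n (xi n (m - k) ^ 2 ^ k * conj_xi n k))"
      by (intro S.finsum_cong') (auto intro!: hom_closed poly_ring_closed poly_ring_power
          xi_in_poly_ring conj_xi_in_poly_ring)
    also have "\<dots> = cls n (conj_xi n m)"
      using False by (simp add: sum_cls[symmetric] conj_xi.simps[of n m] poly_ring_closed
          poly_ring_power xi_in_poly_ring conj_xi_in_poly_ring)
    finally have lower: "(\<Oplus>\<^bsub>A_dual n\<^esub>k\<in>{..<m}. ?t k) = cls n (conj_xi n m)" .
    have "\<zero>\<^bsub>A_dual n\<^esub> = (\<Oplus>\<^bsub>A_dual n\<^esub>k\<in>{0..m}. ?t k)"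
      using assms False by (simp add: antipode_on_xi_def)
    also have "{0..m} = insert m {..<m}"
      by auto
    also have "(\<Oplus>\<^bsub>A_dual n\<^esub>k\<in>insert m {..<m}. ?t k) = ?t m \<oplus>\<^bsub>A_dual n\<^esub> cls n (conj_xi n m)"
      unfolding lower[symmetric]
      by (intro S.finsum_insert) (auto simp: c_closed xi_in_poly_ring)
    \<comment> \<open>Its other factor is a power of \<open>xi n 0\<close>, which is 1.\<close>
    also have "?t m = c (cls n (xi n m))"
      using hom_one c_closed by (simp add: xi_def[of n 0])
    finally have "c (cls n (xi n m)) \<oplus>\<^bsub>A_dual n\<^esub> cls n (conj_xi n m) = \<zero>\<^bsub>A_dual n\<^esub>"
      by simp
    moreover have "cls n (conj_xi n m) \<oplus>\<^bsub>A_dual n\<^esub> cls n (conj_xi n m) = \<zero>\<^bsub>A_dual n\<^esub>"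
      using hom_add[of "conj_xi n m" "conj_xi n m"] hom_zero
      by (simp add: conj_xi_in_poly_ring mpoly_add_self)
    ultimately show ?thesis
      using S.add.right_cancel[of "cls n (conj_xi n m)" "c (cls n (xi n m))" "cls n (conj_xi n m)"]
        c_closed conj_xi_in_poly_ring by simp
  qed
qed

text \<open>
  The products of the edge labels along the directed paths from \<open>2\<^sup>j\<rho>\<close> to \<open>2\<^sup>l\<rho>\<close> in the graph
  with all possible edges.
\<close>

inductive path_mono :: "nat \<Rightarrow> nat \<Rightarrow> mono \<Rightarrow> bool" for j where
  refl: "path_mono j j 0"
| step: "path_mono j k m \<Longrightarrow> k < l \<Longrightarrow> path_mono j l (m + single (Xi (l - k)) (2 ^ k))"

lemma path_mono_le: "path_mono j l m \<Longrightarrow> j \<le> l"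
  by (induction rule: path_mono.induct) auto

lemma path_mono_self: "path_mono j j m \<longleftrightarrow> m = 0"
proof
  show "path_mono j j m \<Longrightarrow> m = 0"
    by (cases rule: path_mono.cases) (auto dest: path_mono_le)
qed (simp add: path_mono.refl)

text \<open>Sorting paths by their last vertex \<open>k\<close> before \<open>l\<close> mirrors the
  recursion of \<open>conj_xi\<close>.\<close>

lemma path_mono_Collect:
  assumes "j < l"
  shows "{m. path_mono j l m} =
    (\<Union>k\<in>{..<l}. (\<lambda>m. m + single (Xi (l - k)) (2 ^ k)) ` {m. path_mono j k m})"
proof (intro equalityI subsetI)
  fix m assume "m \<in> {m. path_mono j l m}"
  then have "path_mono j l m"
    by simp
  then show "m \<in> (\<Union>k\<in>{..<l}. (\<lambda>m. m + single (Xi (l - k)) (2 ^ k)) ` {m. path_mono j k m})"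
    using assms by (cases rule: path_mono.cases) auto
qed (auto intro: path_mono.step)

lemma finite_path_mono: "finite {m. path_mono j l m}"
proof (induction l rule: less_induct)
  case (less l)
  show ?case
  proof (cases j l rule: linorder_cases)
    case less
    then show ?thesis
      using less.IH by (simp add: path_mono_Collect)
  next
    case greater
    then have "{m. path_mono j l m} = {}"
      using path_mono_le by fastforce
    then show ?thesis
      by (simp only: finite.emptyI)
  qed (simp add: path_mono_self)
qed

lemma path_mono_Tau: "path_mono j l m \<Longrightarrow> lookup m (Tau i) = 0"
  by (induction rule: path_mono.induct) (simp_all add: lookup_add lookup_single)

lemma path_mono_Xi_0: "path_mono j l m \<Longrightarrow> lookup m (Xi 0) = 0"
  by (induction rule: path_mono.induct) (auto simp: lookup_add lookup_single when_def)

text \<open>Edges labelled by powers of \<open>Xi i\<close> start at distinct vertices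
  \<open>k\<close> with \<open>k + i \<le> l\<close> and contribute \<open>2^k\<close> each, so the
  exponent is a sum of distinct such powers. For \<open>i > l\<close> truncated subtraction makes
  the bound 1, so the exponent is 0.\<close>

lemma path_mono_Xi_less:
  assumes "path_mono j l m" "1 \<le> i"
  shows "lookup m (Xi i) < 2 ^ (l + 1 - i)"
  using assms(1)
proof (induction rule: path_mono.induct)
  case (step k m l)
  show ?case
  proof (cases "i = l - k")
    case True
    have "lookup m (Xi i) < 2 ^ (k + 1 - i)"
      by fact
    also have "\<dots> \<le> (2::nat) ^ k"
      using assms(2) by (intro power_increasing) auto
    finally have "lookup m (Xi i) + 2 ^ k < 2 ^ (k + 1)"
      by simp
    moreover have "l + 1 - i = k + 1"
      using True step.hyps by simp
    ultimately show ?thesis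
      using True by (simp add: lookup_add)
  next
    case False
    have "lookup m (Xi i) < 2 ^ (k + 1 - i)"
      by fact
    also have "\<dots> \<le> (2::nat) ^ (l + 1 - i)"
      using step.hyps by (intro power_increasing) auto
    finally show ?thesis
      using False by (simp add: lookup_add lookup_single)
  qed
qed simp

text \<open>Used in two ways: for \<open>k' = k\<close> it excludes carries when the last edge is
  appended, and for \<open>k' \<noteq> k\<close> it separates paths with different last
  edges.\<close>

lemma path_mono_Xi_less_power:
  assumes "path_mono j k m" "k < l" "k' < l"
  shows "lookup m (Xi (l - k')) < 2 ^ k'"
proof -
  have "lookup m (Xi (l - k')) < 2 ^ (k + 1 - (l - k'))"
    using assms by (intro path_mono_Xi_less) auto
  also have "\<dots> \<le> (2::nat) ^ k'"
    using assms by (intro power_increasing) auto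
  finally show ?thesis .
qed

lemma path_mono_standard:
  assumes "path_mono j l m" "l \<le> n"
  shows "standard_mono n m"
proof -
  have less: "lookup m (Xi i) < 2 ^ (n + 1 - i)" if "1 \<le> i" for i
  proof -
    note path_mono_Xi_less[OF assms(1) that]
    also have "(2::nat) ^ (l + 1 - i) \<le> 2 ^ (n + 1 - i)"
      using assms(2) by (intro power_increasing) auto
    finally show ?thesis .
  qed
  have "v \<in> gens n" if "lookup m v \<noteq> 0" for v
  proof (cases v)
    case (Xi i)
    then have "1 \<le> i"
      using that path_mono_Xi_0[OF assms(1)] by (cases i) auto
    \<comment> \<open>For \<open>i > n\<close> the bound \<open>2 ^ (n + 1 - i)\<close> is 1,
      forcing exponent 0.\<close>
    moreover have "i \<le> n"
      using less[OF \<open>1 \<le> i\<close>] that Xi by (cases "i \<le> n") auto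
    ultimately show ?thesis
      using Xi by (simp add: gens_def)
  next
    case (Tau i)
    then show ?thesis
      using that path_mono_Tau[OF assms(1)] by simp
  qed
  moreover have "lookup m (Xi i) \<le> 2 ^ (n + 1 - i) - 1" if "1 \<le> i" for i
    using less[OF that] by linarith
  ultimately show ?thesis
    using path_mono_Tau[OF assms(1)] by (auto simp: standard_mono_def in_keys_iff)
qed

text \<open>Frobenius moves the power inside the recursion and shifts the last stop \<open>k\<close>
  to \<open>k + j\<close>. Paths with different last stops have different products, so no terms
  cancel modulo 2.\<close>

lemma conj_xi_power:
  assumes "i + j \<le> n"
  shows "conj_xi n i ^ 2 ^ j = (\<Sum>m | path_mono j (i + j) m. single m 1)"
  using assms
proof (induction i rule: less_induct)
  case (less i)
  show ?case
  proof (cases "i = 0")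
    case True
    then show ?thesis
      by (simp add: conj_xi.simps path_mono_self)
  next
    case False
    let ?P = "\<lambda>k. {m. path_mono j k m}"
    let ?e = "\<lambda>k. single (Xi (i + j - k)) (2 ^ k) :: mono"
    have step: "(xi n (i - k) ^ 2 ^ k * conj_xi n k) ^ 2 ^ j
        = (\<Sum>m\<in>(\<lambda>m. m + ?e (k + j)) ` ?P (k + j). single m 1)" if "k < i" for k
    proof -
      have "xi n (i - k) ^ 2 ^ (k + j) = single (?e (k + j)) 1"
        using that less.prems by (auto simp: xi_def single_generator_power)
      then have "(xi n (i - k) ^ 2 ^ k * conj_xi n k) ^ 2 ^ j
          = single (?e (k + j)) 1 * (\<Sum>m\<in>?P (k + j). single m 1)"
        using less.IH[OF that] that less.prems
        by (simp add: power_mult_distrib power_add flip: power_mult)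
      also have "\<dots> = (\<Sum>m\<in>?P (k + j). single (m + ?e (k + j)) 1)"
        by (simp add: sum_distrib_left mult_single add.commute)
      also have "\<dots> = (\<Sum>m\<in>(\<lambda>m. m + ?e (k + j)) ` ?P (k + j). single m 1)"
        by (subst sum.reindex) (auto simp: inj_on_def)
      finally show ?thesis .
    qed
    \<comment> \<open>A last edge from \<open>k'\<close> forces the exponent of
      \<open>Xi (i + j - k')\<close> to be at least \<open>2^k'\<close>, which a path with another
      last stop cannot reach.\<close>
    have disjoint: "(\<lambda>m. m + ?e k) ` ?P k \<inter> (\<lambda>m. m + ?e k') ` ?P k' = {}"
      if "k < i + j" "k' < i + j" "k \<noteq> k'" for k k'
    proof -
      have False if m: "path_mono j k m" "path_mono j k' m'" "m + ?e k = m' + ?e k'" for m m'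
      proof -
        have "lookup m (Xi (i + j - k')) = lookup (m + ?e k) (Xi (i + j - k'))"
          using \<open>k < i + j\<close> \<open>k' < i + j\<close> \<open>k \<noteq> k'\<close> by (simp add: lookup_add lookup_single)
        also have "\<dots> \<ge> 2 ^ k'"
          by (simp add: m(3) lookup_add)
        finally show False
          using path_mono_Xi_less_power[OF m(1) \<open>k < i + j\<close> \<open>k' < i + j\<close>] by simp
      qed
      then show ?thesis
        by blast
    qed
    have paths: "?P (i + j) = (\<Union>k\<in>{..<i}. (\<lambda>m. m + ?e (k + j)) ` ?P (k + j))"
    proof -
      have "?P (i + j) = (\<Union>k\<in>{..<i + j}. (\<lambda>m. m + ?e k) ` ?P k)"
        using False by (simp add: path_mono_Collect)
      \<comment> \<open>No path from \<open>j\<close> ends below \<open>j\<close>.\<close>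
      also have "\<dots> = (\<Union>k\<in>{j..<i + j}. (\<lambda>m. m + ?e k) ` ?P k)"
        using path_mono_le by fastforce
      also have "{j..<i + j} = (\<lambda>k. k + j) ` {..<i}"
        by (simp add: lessThan_atLeast0)
      finally show ?thesis
        by simp
    qed
    have "conj_xi n i ^ 2 ^ j = (\<Sum>k<i. (xi n (i - k) ^ 2 ^ k * conj_xi n k) ^ 2 ^ j)"
      using False by (simp add: conj_xi.simps[of n i] mpoly_frobenius_sum)
    also have "\<dots> = (\<Sum>k<i. \<Sum>m\<in>(\<lambda>m. m + ?e (k + j)) ` ?P (k + j). single m 1)"
      by (simp add: step)
    also have "\<dots> = (\<Sum>m\<in>?P (i + j). single m 1)"
      unfolding paths
      by (intro sum.UNION_disjoint[symmetric] ballI impI disjoint) (simp_all add: finite_path_mono)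
    finally show ?thesis .
  qed
qed

lemma keys_sum_single:
  assumes "finite S"
  shows "keys (\<Sum>m\<in>S. single m (1::'a::comm_ring_1)) = S"
  using assms by (auto simp: in_keys_iff lookup_sum lookup_single when_def split: if_splits)

text \<open>Since \<open>i + j \<le> n\<close>, the path sum involves only standard monomials, so by
  uniqueness it is the basis expansion.\<close>

lemma summand_antipode_iff:
  assumes "antipode_on_xi n c" "i + j \<le> n"
  shows "summand n (c (cls n (xi n i) [^]\<^bsub>A_dual n\<^esub> ((2::nat) ^ j))) m \<longleftrightarrow> path_mono j (i + j) m"
proof -
  let ?p = "\<Sum>m | path_mono j (i + j) m. single m (1::M2)"
  interpret ring_hom_ring "poly_ring n" "A_dual n" "cls n"
    by (rule cls_ring_hom)
  interpret c: ring_hom_ring "A_dual n" "A_dual n" c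
    using assms(1) by (intro ring_hom_ringI2 S.ring_axioms) (simp add: antipode_on_xi_def)
  have keys: "keys ?p = {m. path_mono j (i + j) m}"
    by (rule keys_sum_single[OF finite_path_mono])
  then have standard: "\<forall>k\<in>keys ?p. standard_mono n k"
    using path_mono_standard assms(2) by blast
  have "c (cls n (xi n i) [^]\<^bsub>A_dual n\<^esub> ((2::nat) ^ j)) = cls n (conj_xi n i ^ 2 ^ j)"
    using hom_nat_pow[of "conj_xi n i" "2 ^ j"]
    by (simp add: c.hom_nat_pow xi_in_poly_ring conj_xi_in_poly_ring
        antipode_eq_cls_conj_xi[OF assms(1)])
  then have "c (cls n (xi n i) [^]\<^bsub>A_dual n\<^esub> ((2::nat) ^ j)) = cls n ?p"
    by (simp add: conj_xi_power[OF assms(2)])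
  then show ?thesis
    unfolding summand_def using standard standard_expansion_unique keys by (metis mem_Collect_eq)
qed

section \<open>Factors and directed paths\<close>

text \<open>Adding \<open>2^k\<close> to a number below \<open>2^k\<close> produces no carry: only
  binary digit \<open>k\<close> changes, from 0 to 1.\<close>

lemma digit_add_power:
  assumes "lookup m (Xi a) < 2 ^ k"
  shows "digit (m + single (Xi a) (2 ^ k)) i b = digit m i b + of_bool (i = a \<and> b = k)"
proof (cases "i = a")
  case True
  define y where "y = lookup m (Xi a)"
  have y: "y < 2 ^ k"
    using assms by (simp add: y_def)
  have "(y + 2 ^ k) div 2 ^ b mod 2 = y div 2 ^ b mod 2 + of_bool (b = k)"
  proof (cases b k rule: linorder_cases)
    case less
    then obtain t where "k = Suc (b + t)"
      using less_imp_Suc_add by blast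
    then have "(2::nat) ^ k = 2 ^ t * 2 * 2 ^ b"
      by (simp add: power_add)
    then have "(y + 2 ^ k) div 2 ^ b = 2 ^ t * 2 + y div 2 ^ b"
      by (simp only: div_mult_self1 power_not_zero zero_neq_numeral[symmetric] not_False_eq_True)
    then show ?thesis
      using less by simp
  next
    case greater
    then have "(2::nat) ^ k * 2 \<le> 2 ^ b"
      by (metis Suc_leI power_Suc2 power_increasing one_le_numeral)
    then show ?thesis
      using y greater by simp
  qed (use y in simp)
  then show ?thesis
    using True by (simp add: digit_def lookup_add y_def)
next
  case False
  then show ?thesis
    by (simp add: digit_def lookup_add lookup_single)
qed

text \<open>Edges are indexed by their endpoints and not bounded by \<open>n\<close>, so that
  directed paths become a plain reflexive transitive closure.\<close>

definition xi_edge :: "mono \<Rightarrow> nat \<Rightarrow> nat \<Rightarrow> bool" where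
  "xi_edge x k l \<longleftrightarrow> k < l \<and> digit x (l - k) k = 1"

text \<open>The appended label occupies a binary digit that is still 0 in \<open>m\<close>, so
  divisibility can be tested separately on \<open>m\<close> and on the new edge.\<close>

lemma factor_path_mono_step:
  assumes "path_mono j k m" "k < l"
  shows "factor (m + single (Xi (l - k)) (2 ^ k)) x \<longleftrightarrow> factor m x \<and> xi_edge x k l"
proof -
  have less: "lookup m (Xi (l - k)) < 2 ^ k"
    by (rule path_mono_Xi_less_power[OF assms(1,2,2)])
  then have "digit m (l - k) k = 0"
    by (simp add: digit_def)
  moreover have "digit x (l - k) k \<le> 1"
    by (simp add: digit_def)
  ultimately show ?thesis
    using assms(2)
    by (auto simp: factor_def xi_edge_def digit_add_power[OF less] lookup_add lookup_single
        of_bool_def split: if_splits)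
      (metis add.right_neutral le_antisym le_add2 le_trans)+
qed

lemma factor_path_mono_iff:
  "(\<exists>m. path_mono j l m \<and> factor m x) \<longleftrightarrow> (xi_edge x)\<^sup>*\<^sup>* j l"
proof
  assume "\<exists>m. path_mono j l m \<and> factor m x"
  then obtain m where "path_mono j l m" "factor m x"
    by blast
  then show "(xi_edge x)\<^sup>*\<^sup>* j l"
  proof (induction rule: path_mono.induct)
    case (step k m l)
    then show ?case
      by (metis factor_path_mono_step rtranclp.rtrancl_into_rtrancl)
  qed simp
next
  assume "(xi_edge x)\<^sup>*\<^sup>* j l"
  then show "\<exists>m. path_mono j l m \<and> factor m x"
  proof (induction rule: rtranclp_induct)
    case base
    have "factor 0 x"
      by (simp add: factor_def digit_def)
    then show ?case
      using path_mono.refl by blast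
  next
    case (step k l)
    then show ?case
      by (metis factor_path_mono_step path_mono.step xi_edge_def)
  qed
qed

section \<open>Arcs and reachability in the directed graph\<close>

lemma arg_min_rep_dim:
  assumes "rep_dim v < rep_dim w"
  shows "(ARG_MIN rep_dim u. u \<in> {v, w}) = v" "(ARG_MAX rep_dim u. u \<in> {v, w}) = w"
  unfolding arg_min_def is_arg_min_def arg_max_def is_arg_max_def
  using assms by (auto intro!: some_equality)

text \<open>Labels are dropped and the pair \<open>(i, j)\<close> is replaced by the endpoints
  \<open>(j, i + j)\<close>, which is all that reachability depends on.\<close>

lemma arcs_ends_dir_graph:
  "arcs_ends (dir_graph n x) =
    {(Sigma, Rho i) | i. i \<le> n \<and> lookup x (Tau i) = 1} \<union>
    {(Rho k, Rho l) | k l. l \<le> n \<and> xi_edge x k l}"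
  (is "_ = ?T \<union> ?X")
proof -
  let ?ends = "arc_to_ends (dir_graph n x)"
  have tau: "?ends ({Sigma, Rho i}, m) = (Sigma, Rho i)" for i m
  proof -
    have "rep_dim Sigma < rep_dim (Rho i)"
      using one_le_power[of "2::nat" i] unfolding rep_dim.simps by linarith
    from arg_min_rep_dim[OF this] show ?thesis
      by (simp add: arc_to_ends_def dir_graph_def)
  qed
  have xi: "?ends ({Rho k, Rho (i + k)}, m) = (Rho k, Rho (i + k))" if "1 \<le> i" for i k m
  proof -
    have "rep_dim (Rho k) < rep_dim (Rho (i + k))"
      using that by simp
    from arg_min_rep_dim[OF this] show ?thesis
      by (simp add: arc_to_ends_def dir_graph_def)
  qed
  have "arcs_ends (dir_graph n x) = ?ends ` graph_edges n x"
    by (simp add: arcs_ends_def dir_graph_def)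
  also have "\<dots> = ?T \<union> {(Rho k, Rho (i + k)) | i k. 1 \<le> i \<and> i \<le> n \<and> k \<le> n - i \<and> digit x i k = 1}"
  proof -
    have image1: "f ` {g i | i. P i} = {f (g i) | i. P i}"
      for f :: "edge \<Rightarrow> rep \<times> rep" and g and P :: "nat \<Rightarrow> bool"
      by blast
    have image2: "f ` {g i k | i k. P i k} = {f (g i k) | i k. P i k}"
      for f :: "edge \<Rightarrow> rep \<times> rep" and g and P :: "nat \<Rightarrow> nat \<Rightarrow> bool"
      by blast
    have "{?ends ({Rho k, Rho (i + k)}, mono_of (Xi i) (2 ^ k)) | i k.
        1 \<le> i \<and> i \<le> n \<and> k \<le> n - i \<and> digit x i k = 1} =
      {(Rho k, Rho (i + k)) | i k. 1 \<le> i \<and> i \<le> n \<and> k \<le> n - i \<and> digit x i k = 1}"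
      by (intro Collect_cong ex_cong1) (auto simp: xi)
    then show ?thesis
      unfolding graph_edges_def image_Un image1 image2 tau by (rule arg_cong)
  qed
  also have "{(Rho k, Rho (i + k)) | i k. 1 \<le> i \<and> i \<le> n \<and> k \<le> n - i \<and> digit x i k = 1} = ?X"
  proof (intro equalityI subsetI)
    fix e assume "e \<in> ?X"
    then obtain k l where "e = (Rho k, Rho l)" "l \<le> n" "k < l" "digit x (l - k) k = 1"
      by (auto simp: xi_edge_def)
    then have "e = (Rho k, Rho (l - k + k)) \<and> 1 \<le> l - k \<and> l - k \<le> n \<and> k \<le> n - (l - k)
        \<and> digit x (l - k) k = 1"
      by auto
    then show "e \<in> {(Rho k, Rho (i + k)) | i k. 1 \<le> i \<and> i \<le> n \<and> k \<le> n - i \<and> digit x i k = 1}"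
      by blast
  qed (auto simp: xi_edge_def)
  finally show ?thesis .
qed

lemma verts_dir_graph: "verts (dir_graph n x) = insert Sigma (Rho ` {0..n})"
  by (simp add: dir_graph_def graph_verts_def)

lemma wf_digraph_dir_graph: "wf_digraph (dir_graph n x)"
proof
  fix e assume "e \<in> arcs (dir_graph n x)"
  then have "(tail (dir_graph n x) e, head (dir_graph n x) e) \<in> arcs_ends (dir_graph n x)"
    by (auto simp: arcs_ends_def arc_to_ends_def)
  then show "tail (dir_graph n x) e \<in> verts (dir_graph n x)"
    "head (dir_graph n x) e \<in> verts (dir_graph n x)"
    by (auto simp: arcs_ends_dir_graph verts_dir_graph xi_edge_def)
qed

lemma unilateral_iff_reachable:
  "unilateral (dir_graph n x) \<longleftrightarrow>
    (\<forall>v\<in>verts (dir_graph n x). \<forall>w\<in>verts (dir_graph n x). v \<noteq> w \<longrightarrow>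
      v \<rightarrow>\<^sup>*\<^bsub>dir_graph n x\<^esub> w \<or> w \<rightarrow>\<^sup>*\<^bsub>dir_graph n x\<^esub> v)"
  by (simp add: unilateral_def wf_digraph.reachable_apath[OF wf_digraph_dir_graph])

text \<open>No arc enters \<open>Sigma\<close>, so a path leaving a \<open>Rho\<close> vertex
  follows \<open>xi_edge\<close> throughout.\<close>

lemma reachable_from_Rho:
  assumes "Rho j \<rightarrow>\<^sup>*\<^bsub>dir_graph n x\<^esub> v"
  shows "\<exists>l. v = Rho l \<and> (xi_edge x)\<^sup>*\<^sup>* j l"
  using assms
proof (induction rule: wf_digraph.reachable_induct[OF wf_digraph_dir_graph, consumes 1,
      case_names base step])
  case (step v w)
  then show ?case
    by (auto simp: arcs_ends_dir_graph intro: rtranclp.rtrancl_into_rtrancl)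
qed simp

lemma xi_edge_rtranclp_le: "(xi_edge x)\<^sup>*\<^sup>* j l \<Longrightarrow> j \<le> l"
  by (induction rule: rtranclp_induct) (auto simp: xi_edge_def)

lemma reachable_Rho_iff:
  assumes "l \<le> n"
  shows "Rho j \<rightarrow>\<^sup>*\<^bsub>dir_graph n x\<^esub> Rho l \<longleftrightarrow> (xi_edge x)\<^sup>*\<^sup>* j l"
proof
  interpret wf_digraph "dir_graph n x"
    by (rule wf_digraph_dir_graph)
  assume "(xi_edge x)\<^sup>*\<^sup>* j l"
  then show "Rho j \<rightarrow>\<^sup>*\<^bsub>dir_graph n x\<^esub> Rho l"
    using assms
  proof (induction rule: rtranclp_induct)
    case base
    then show ?case
      by (simp add: verts_dir_graph)
  next
    case (step k l)
    \<comment> \<open>Since \<open>xi_edge\<close> increases the index, the bound by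
      \<open>n\<close> passes from \<open>l\<close> to \<open>k\<close>.\<close>
    then have "Rho j \<rightarrow>\<^sup>*\<^bsub>dir_graph n x\<^esub> Rho k" "Rho k \<rightarrow>\<^bsub>dir_graph n x\<^esub> Rho l"
      by (auto simp: arcs_ends_dir_graph xi_edge_def)
    then show ?case
      by (rule reachable_adj_trans)
  qed
qed (auto dest: reachable_from_Rho)

text \<open>Arcs between \<open>Rho\<close> vertices increase the index, so the last arc into
  \<open>Rho 0\<close> must come from \<open>Sigma\<close>.\<close>

lemma reachable_Sigma_Rho_0:
  assumes "Sigma \<rightarrow>\<^sup>*\<^bsub>dir_graph n x\<^esub> Rho 0"
  shows "lookup x (Tau 0) = 1"
proof -
  have "v = Rho 0 \<longrightarrow> lookup x (Tau 0) = 1" if "Sigma \<rightarrow>\<^sup>*\<^bsub>dir_graph n x\<^esub> v" for v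
    using that
    by (induction rule: wf_digraph.reachable_induct[OF wf_digraph_dir_graph, consumes 1])
      (auto simp: arcs_ends_dir_graph xi_edge_def)
  then show ?thesis
    using assms by blast
qed

lemma unilateral_dir_graph_iff:
  "unilateral (dir_graph n x) \<longleftrightarrow>
    (\<forall>j l. j < l \<and> l \<le> n \<longrightarrow> (xi_edge x)\<^sup>*\<^sup>* j l) \<and> lookup x (Tau 0) = 1"
proof
  assume unilateral: "unilateral (dir_graph n x)"
  have "(xi_edge x)\<^sup>*\<^sup>* j l" if "j < l" "l \<le> n" for j l
  proof -
    \<comment> \<open>Monotonicity rules out the downward direction, leaving the upward one from
      unilaterality.\<close>
    have "\<not> (xi_edge x)\<^sup>*\<^sup>* l j"
      using xi_edge_rtranclp_le that(1) by fastforce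
    then show ?thesis
      using unilateral[unfolded unilateral_iff_reachable, rule_format, of "Rho j" "Rho l"] that
      by (auto simp: verts_dir_graph reachable_Rho_iff)
  qed
  moreover have "Sigma \<rightarrow>\<^sup>*\<^bsub>dir_graph n x\<^esub> Rho 0"
    using unilateral
    by (auto simp: unilateral_iff_reachable verts_dir_graph dest: reachable_from_Rho)
  ultimately show "(\<forall>j l. j < l \<and> l \<le> n \<longrightarrow> (xi_edge x)\<^sup>*\<^sup>* j l) \<and> lookup x (Tau 0) = 1"
    using reachable_Sigma_Rho_0 by blast
next
  interpret wf_digraph "dir_graph n x"
    by (rule wf_digraph_dir_graph)
  assume paths: "(\<forall>j l. j < l \<and> l \<le> n \<longrightarrow> (xi_edge x)\<^sup>*\<^sup>* j l) \<and> lookup x (Tau 0) = 1"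
  have Rho: "Rho j \<rightarrow>\<^sup>*\<^bsub>dir_graph n x\<^esub> Rho l" if "j \<le> l" "l \<le> n" for j l
    using paths that by (cases "j = l") (auto simp: reachable_Rho_iff)
  have "Sigma \<rightarrow>\<^bsub>dir_graph n x\<^esub> Rho 0"
    using paths by (simp add: arcs_ends_dir_graph)
  \<comment> \<open>The single arc to \<open>Rho 0\<close> suffices, because every other
    \<open>Rho\<close> vertex is reachable from there.\<close>
  then have "Sigma \<rightarrow>\<^sup>*\<^bsub>dir_graph n x\<^esub> Rho l" if "l \<le> n" for l
    using Rho[of 0 l] that by (auto intro: adj_reachable_trans)
  moreover have "Rho j \<rightarrow>\<^sup>*\<^bsub>dir_graph n x\<^esub> Rho l \<or> Rho l \<rightarrow>\<^sup>*\<^bsub>dir_graph n x\<^esub> Rho j"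
    if "j \<le> n" "l \<le> n" for j l
    using Rho that by (cases "j \<le> l") auto
  ultimately show "unilateral (dir_graph n x)"
    by (simp add: unilateral_iff_reachable verts_dir_graph)
qed

theorem corollary4p14:
  fixes n :: nat and x :: mono and c :: "mpoly set \<Rightarrow> mpoly set"
  assumes "standard_mono n x" and "antipode_on_xi n c"
  shows "unilateral (dir_graph n x) \<longleftrightarrow>
    (\<forall>i j. 1 \<le> i \<and> i + j \<le> n \<longrightarrow>
       (\<exists>m. summand n (c (cls n (xi n i) [^]\<^bsub>A_dual n\<^esub> ((2::nat) ^ j))) m \<and> factor m x)) \<and>
    factor (mono_of (Tau 0) 1) x"
proof -
  \<comment> \<open>Standard form turns divisibility by \<open>Tau 0\<close> (exponent at least 1)
    into exponent exactly 1, as required by the edge condition.\<close>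
  have "lookup x (Tau 0) \<in> {0, 1}"
    using assms(1) unfolding standard_mono_def by blast
  then have tau: "factor (mono_of (Tau 0) 1) x \<longleftrightarrow> lookup x (Tau 0) = 1"
    by (auto simp: factor_def digit_def lookup_single when_def)
  have "(\<forall>i j. 1 \<le> i \<and> i + j \<le> n \<longrightarrow>
      (\<exists>m. summand n (c (cls n (xi n i) [^]\<^bsub>A_dual n\<^esub> ((2::nat) ^ j))) m \<and> factor m x))
    \<longleftrightarrow> (\<forall>i j. 1 \<le> i \<and> i + j \<le> n \<longrightarrow> (xi_edge x)\<^sup>*\<^sup>* j (i + j))"
    using summand_antipode_iff[OF assms(2)] factor_path_mono_iff by metis
  also have "\<dots> \<longleftrightarrow> (\<forall>j l. j < l \<and> l \<le> n \<longrightarrow> (xi_edge x)\<^sup>*\<^sup>* j l)"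
  proof (intro iffI allI impI)
    fix j l
    assume "\<forall>i j. 1 \<le> i \<and> i + j \<le> n \<longrightarrow> (xi_edge x)\<^sup>*\<^sup>* j (i + j)" "j < l \<and> l \<le> n"
    then show "(xi_edge x)\<^sup>*\<^sup>* j l"
      by (metis One_nat_def Suc_leI le_add_diff_inverse2 less_imp_le zero_less_diff)
  qed auto
  finally show ?thesis
    by (simp only: unilateral_dir_graph_iff tau)
qed

end
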